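(* Let $q$ be prime, let $n,k\ge1$ be integers, and let $\boldsymbol\alpha\in\mathbb{F}_q^n$ have distinct nonzero entries. Then the code $\mathrm{GRS}_{q,k}(\boldsymbol\alpha,\boldsymbol\alpha)\subseteq\mathbb{F}_q^n$, of rate $R=k/n$, has $\ell_1$ minimum distance at least $$\frac{(n+1)^2-k^2}{4k}\;>\;\frac{1-R^2}{4R}\cdot n .$$
   Context: $\mathrm{GRS}_{q,k}(\boldsymbol\alpha,\mathbf{t})=\{(t_1g(\alpha_1),\dots,t_ng(\alpha_n)):g\in\mathbb{F}_q[x],\ \deg g<k\}$ is the generalized Reed–Solomon code with evaluation points $\boldsymbol\alpha$ (distinct entries) and twist factors $\mathbf{t}$ (nonzero entries); here $\mathbf{t}=\boldsymbol\alpha$. Identify $\mathbb{F}_q=\mathbb{Z}/q\mathbb{Z}$; for $x\in\mathbb{F}_q$, $\overline{x}$ is its unique integer representative in $[-q/2,q/2)$, and $\|\mathbf{x}\|_1=\sum_i|\overline{x_i}|$ for $\mathbf{x}\in\mathbb{F}_q^n$. The $\ell_1$ (Lee) minimum distance of a linear code is the minimum of $\|\mathbf{c}\|_1$ over its nonzero codewords $\mathbf{c}$. *)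

theory Defs
  imports
    "HOL-Analysis.Analysis"
    "Berlekamp_Zassenhaus.Finite_Field"
begin

text \<open>
  The field with \<open>q\<close> elements, \<open>q\<close> prime, is \<open>'q mod_ring\<close> with \<open>'q\<close> of class \<open>prime_card\<close>
  and \<open>q = CARD('q)\<close>. Vectors of length \<open>n\<close> over it are of type \<open>'q mod_ring ^ 'n\<close> with
  \<open>n = CARD('n)\<close>.
\<close>

definition centered_rep :: "'q::prime_card mod_ring \<Rightarrow> int" where
  "centered_rep x = (THE z::int. of_int z = x \<and>
     real_of_int z \<in> {- real CARD('q) / 2 ..< real CARD('q) / 2})"

lemma ex1_centered_rep:
  fixes x :: "'q::prime_card mod_ring"
  shows "\<exists>!z::int. of_int z = x \<and>
     real_of_int z \<in> {- real CARD('q) / 2 ..< real CARD('q) / 2}"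
proof -
  let ?q = "int CARD('q)"
  have q: "?q > 0" by simp
  have eq_iff: "(of_int z :: 'q mod_ring) = of_int w \<longleftrightarrow> z mod ?q = w mod ?q" for z w
    unfolding of_int_of_int_mod_ring by transfer simp
  have rng: "real_of_int z \<in> {- real CARD('q) / 2 ..< real CARD('q) / 2} \<longleftrightarrow>
      - ?q \<le> 2 * z \<and> 2 * z < ?q" for z
    by (simp; linarith)
  define y where "y = to_int_mod_ring x"
  have y: "0 \<le> y" "y < ?q" "of_int y = x"
    unfolding y_def of_int_of_int_mod_ring
    using range_to_int_mod_ring[where 'a='q] by auto
  define z where "z = (if 2 * y < ?q then y else y - ?q)"
  have z: "- ?q \<le> 2 * z \<and> 2 * z < ?q" using y by (auto simp: z_def)
  have zx: "of_int z = x" using y(3) by (auto simp: z_def)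
  show ?thesis
  proof (rule ex1I[of _ z])
    show "of_int z = x \<and> real_of_int z \<in> {- real CARD('q) / 2 ..< real CARD('q) / 2}"
      using z zx rng by blast
  next
    fix w :: int
    assume w: "of_int w = x \<and> real_of_int w \<in> {- real CARD('q) / 2 ..< real CARD('q) / 2}"
    have w2: "- ?q \<le> 2 * w \<and> 2 * w < ?q" using w rng by blast
    have "w mod ?q = z mod ?q" using w zx eq_iff[of w z] by simp
    then have "?q dvd w - z" by (simp add: mod_eq_dvd_iff)
    moreover have "\<bar>w - z\<bar> < ?q" using w2 z by linarith
    ultimately show "w = z" using zdvd_not_zless[of "\<bar>w - z\<bar>" ?q] by auto
  qed
qed

definition l1_norm :: "'q::prime_card mod_ring ^ 'n \<Rightarrow> int" where
  "l1_norm x = (\<Sum>i\<in>UNIV. \<bar>centered_rep (x $ i)\<bar>)"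

definition l1_min_dist :: "('q::prime_card mod_ring ^ 'n) set \<Rightarrow> int" where
  "l1_min_dist C = Min (l1_norm ` (C - {0}))"

definition code_rate :: "('a::{field,finite} ^ 'n) set \<Rightarrow> real" where
  "code_rate C = log (real CARD('a)) (real (card C)) / real CARD('n)"

text \<open>
  Since \<open>degree 0 = 0\<close> in the library, the disjunct \<open>g = 0\<close> renders the convention that the zero
  polynomial has degree below every \<open>k\<close>.
\<close>

definition GRS :: "nat \<Rightarrow> 'a::field ^ 'n \<Rightarrow> 'a ^ 'n \<Rightarrow> ('a ^ 'n) set" where
  "GRS k \<alpha> t = {\<chi> i. t $ i * poly g (\<alpha> $ i) | g. g = 0 \<or> degree g < k}"

end

theory Submission
  imports Defs
begin

text \<open>
  A nonzero codeword has entries \<open>f(\<alpha>\<^sub>i)\<close>, where \<open>f = x g\<close> is nonconstant of degree at most \<open>k\<close>.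
  Hence every nonzero value occurs at most \<open>k\<close> times and \<open>0\<close> at most \<open>k - 1\<close> times, as no
  \<open>\<alpha>\<^sub>i\<close> vanishes. So at most \<open>k - 1 + 2kt\<close> entries have absolute value at most \<open>t\<close>, and
  \<open>\<Sum>\<^sub>i |c\<^sub>i| \<ge> \<Sum>\<^sub>t\<^sub><\<^sub>T (n + 1 - k - 2kt) = T (n + 1 - k) - k T (T - 1)\<close> for every \<open>T\<close>. The choice
  \<open>T = \<lfloor>(n + 1 - k) / 2k\<rfloor> + 1\<close> gives the bound.
\<close>

lemma of_int_centered_rep: "of_int (centered_rep x) = x"
  unfolding centered_rep_def using theI'[OF ex1_centered_rep[of x]] by blast

text \<open>Distinct evaluation points turn the root bound for field elements into one for
  indices.\<close>

lemma card_roots_at_coords_le: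
  fixes \<alpha> :: "'a::field ^ 'n"
  assumes inj: "inj (($) \<alpha>)" and "p \<noteq> 0"
  shows "card {i. poly p (\<alpha> $ i) = 0} \<le> degree p"
proof -
  have "card {i. poly p (\<alpha> $ i) = 0} = card (($) \<alpha> ` {i. poly p (\<alpha> $ i) = 0})"
    by (rule card_image[symmetric]) (rule inj_on_subset[OF inj], simp)
  also have "\<dots> \<le> card {x. poly p x = 0}"
    using assms(2) by (intro card_mono poly_roots_finite) auto
  also have "\<dots> \<le> degree p"
    by (rule poly_roots_degree[OF assms(2)])
  finally show ?thesis .
qed

text \<open>Such a polynomial is determined by its first k coefficients, which are arbitrary; the
  disjunct \<open>g = 0\<close> makes this correct for k = 0 as well.\<close>

lemma card_poly_degree_less:
  "card {g :: 'a::{comm_monoid_add,finite} poly. g = 0 \<or> degree g < k} = CARD('a) ^ k"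
proof -
  let ?P = "{g :: 'a poly. g = 0 \<or> degree g < k}"
  have "bij_betw (\<lambda>g. map (poly.coeff g) [0..<k]) ?P {xs. length xs = k}"
  proof (rule bij_betw_byWitness[where f' = Poly])
    show "\<forall>g\<in>?P. Poly (map (poly.coeff g) [0..<k]) = g"
      by (auto intro!: poly_eqI simp: nth_default_def coeff_eq_0)
    show "\<forall>xs\<in>{xs. length xs = k}. map (poly.coeff (Poly xs)) [0..<k] = xs"
      by (auto intro!: nth_equalityI simp: nth_default_def)
    have "degree (Poly xs) < length xs" if "Poly xs \<noteq> 0" for xs :: "'a list"
    proof -
      have "poly.coeff (Poly xs) (degree (Poly xs)) \<noteq> 0"
        using that by (simp only: leading_coeff_0_iff not_False_eq_True)
      then show ?thesis
        by (auto simp: nth_default_def split: if_splits)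
    qed
    then show "Poly ` {xs. length xs = k} \<subseteq> ?P" by blast
  qed auto
  then show ?thesis
    using bij_betw_same_card card_lists_length_eq[of "UNIV :: 'a set" k] by force
qed

text \<open>Evaluation is injective: two polynomials with the same codeword differ by one of degree
  below k \<le> n that vanishes at n distinct points. So the code has \<open>CARD('a) ^ k\<close>
  elements.\<close>

lemma code_rate_GRS:
  fixes \<alpha> t :: "'a::{field,finite} ^ 'n"
  assumes inj: "inj (($) \<alpha>)" and t: "\<And>i. t $ i \<noteq> 0" and k: "k \<le> CARD('n)"
  shows "code_rate (GRS k \<alpha> t) = real k / real CARD('n)"
proof -
  let ?P = "{g :: 'a poly. g = 0 \<or> degree g < k}"
  let ?e = "\<lambda>g. \<chi> i. t $ i * poly g (\<alpha> $ i)"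
  have "inj_on ?e ?P"
  proof (rule inj_onI)
    fix g h assume gh: "g \<in> ?P" "h \<in> ?P" and eq: "?e g = ?e h"
    have "poly (g - h) (\<alpha> $ i) = 0" for i
      using arg_cong[OF eq, of "\<lambda>v. v $ i"] t[of i] by simp
    then have all: "{i. poly (g - h) (\<alpha> $ i) = 0} = UNIV" by auto
    show "g = h"
    proof (rule ccontr)
      assume ne: "g \<noteq> h"
      then have "CARD('n) \<le> degree (g - h)"
        using card_roots_at_coords_le[OF inj, of "g - h"] unfolding all by simp
      moreover have "degree (g - h) < k"
        using gh ne degree_diff_less[of g k h] by auto
      ultimately show False using k by linarith
    qed
  qed
  moreover have "GRS k \<alpha> t = ?e ` ?P"
    unfolding GRS_def by blast
  ultimately have card: "card (GRS k \<alpha> t) = CARD('a) ^ k"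
    by (simp only: card_image card_poly_degree_less)
  \<comment> \<open>The base of the logarithm must exceed 1.\<close>
  have "card {0 :: 'a, 1} \<le> CARD('a)" by (intro card_mono) auto
  then have "CARD('a) > 1" by simp
  then show ?thesis
    unfolding code_rate_def card by (simp add: log_nat_power)
qed

text \<open>An integer z \<ge> 0 is the number of naturals s < z; cutting off at T only lowers this
  count. Summing over the entries and swapping the sums gives the bound.\<close>

lemma l1_norm_layer_cake:
  "l1_norm x \<ge> (\<Sum>s<T. int (card {i. \<bar>centered_rep (x $ i)\<bar> > int s}))"
proof -
  have card: "int (card {i. \<bar>centered_rep (x $ i)\<bar> > int s}) =
      (\<Sum>i\<in>UNIV. if \<bar>centered_rep (x $ i)\<bar> > int s then 1 else 0)" for s
    by (simp add: sum.If_cases)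
  have "(\<Sum>s<T. if z > int s then 1 else 0) \<le> z" if "z \<ge> 0" for z :: int
  proof -
    have "(\<Sum>s<T. if z > int s then 1 else 0) = int (card ({..<T} \<inter> {s. z > int s}))"
      by (simp add: sum.If_cases)
    also have "card ({..<T} \<inter> {s. z > int s}) \<le> card {..<nat z}"
      by (intro card_mono) auto
    finally show ?thesis using that by simp
  qed
  then show ?thesis
    unfolding card l1_norm_def by (subst sum.swap) (intro sum_mono, simp)
qed

lemma card_small_entries_le:
  fixes \<alpha> :: "'q::prime_card mod_ring ^ 'n"
  assumes inj: "inj (($) \<alpha>)" and nonzero: "\<And>i. \<alpha> $ i \<noteq> 0"
    and g: "g \<noteq> 0" "degree g < k"
  shows "card {i. \<bar>centered_rep (\<alpha> $ i * poly g (\<alpha> $ i))\<bar> \<le> int t} \<le> k - 1 + 2 * t * k"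
proof -
  \<comment> \<open>Zero entries are counted by the roots of g alone, which saves 1 in the degree.
    The polynomial in \<open>?V z\<close> is x g(x) - z. For large t several z may represent the
    same field element, which is harmless in a union bound.\<close>
  let ?Z = "{i. poly g (\<alpha> $ i) = 0}"
  let ?V = "\<lambda>z::int. {i. poly (pCons (- of_int z) g) (\<alpha> $ i) = 0}"
  let ?J = "{- int t..int t} - {0}"
  have "i \<in> ?Z \<union> (\<Union>z\<in>?J. ?V z)"
    if "\<bar>centered_rep (\<alpha> $ i * poly g (\<alpha> $ i))\<bar> \<le> int t" for i
  proof -
    define z where "z = centered_rep (\<alpha> $ i * poly g (\<alpha> $ i))"
    have z: "of_int z = \<alpha> $ i * poly g (\<alpha> $ i)"
      unfolding z_def by (rule of_int_centered_rep)
    show ?thesis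
    proof (cases "z = 0")
      case True
      then show ?thesis using z nonzero[of i] by simp
    next
      case False
      then have "z \<in> ?J" using that unfolding z_def[symmetric] by auto
      moreover have "i \<in> ?V z" using z by simp
      ultimately show ?thesis by blast
    qed
  qed
  then have "card {i. \<bar>centered_rep (\<alpha> $ i * poly g (\<alpha> $ i))\<bar> \<le> int t} \<le>
      card (?Z \<union> (\<Union>z\<in>?J. ?V z))"
    by (intro card_mono) auto
  also have "\<dots> \<le> card ?Z + card (\<Union>z\<in>?J. ?V z)"
    by (rule card_Un_le)
  also have "card (\<Union>z\<in>?J. ?V z) \<le> (\<Sum>z\<in>?J. card (?V z))"
    by (rule card_UN_le) simp
  also have "\<dots> \<le> (\<Sum>z\<in>?J. k)"
  proof (rule sum_mono)
    fix z
    have "card (?V z) \<le> degree (pCons (- of_int z) g)"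
      using g(1) by (intro card_roots_at_coords_le[OF inj]) simp
    then show "card (?V z) \<le> k" using g by simp
  qed
  also have "\<dots> = 2 * t * k"
    by (simp add: nat_add_distrib nat_mult_distrib)
  also have "card ?Z \<le> k - 1"
    using card_roots_at_coords_le[OF inj g(1)] g(2) by linarith
  finally show ?thesis by simp
qed

lemma l1_norm_GRS_ge:
  fixes \<alpha> :: "'q::prime_card mod_ring ^ 'n"
  assumes inj: "inj (($) \<alpha>)" and nonzero: "\<And>i. \<alpha> $ i \<noteq> 0"
    and c: "c \<in> GRS k \<alpha> \<alpha>" "c \<noteq> 0"
  shows "(int CARD('n) + 1)\<^sup>2 - (int k)\<^sup>2 \<le> 4 * int k * l1_norm c"
proof (cases "k \<le> CARD('n)")
  case False
  \<comment> \<open>Here n + 1 \<le> k, so the left side of the claim is at most 0.\<close>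
  then have "(int CARD('n) + 1)\<^sup>2 \<le> (int k)\<^sup>2" by (intro power_mono) auto
  moreover have "l1_norm c \<ge> 0" unfolding l1_norm_def by (simp add: sum_nonneg)
  ultimately show ?thesis by (smt (verit) mult_nonneg_nonneg of_nat_0_le_iff)
next
  case True
  from c obtain g where cg: "c = (\<chi> i. \<alpha> $ i * poly g (\<alpha> $ i))" and g: "g = 0 \<or> degree g < k"
    unfolding GRS_def by blast
  have g0: "g \<noteq> 0" using c(2) unfolding cg by (auto simp: vec_eq_iff)
  with g have deg: "degree g < k" by simp
  define m where "m = int CARD('n) + 1 - int k"
  have m: "m > 0" using True by (simp add: m_def)
  have layer: "int (card {i. \<bar>centered_rep (c $ i)\<bar> > int s}) \<ge> m - 2 * int k * int s" for s
  proof -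
    let ?S = "{i. \<bar>centered_rep (c $ i)\<bar> \<le> int s}"
    have "card {i. \<bar>centered_rep (c $ i)\<bar> > int s} = card (- ?S)"
      by (rule arg_cong[of _ _ card]) auto
    moreover have "card (- ?S) + card ?S = CARD('n)"
      by (simp add: Compl_eq_Diff_UNIV card_Diff_subset card_mono)
    moreover have "card ?S \<le> k - 1 + 2 * s * k"
      using card_small_entries_le[OF inj nonzero g0 deg, of s] unfolding cg by simp
    then have "int (card ?S) \<le> int (k - 1 + 2 * s * k)"
      by (rule of_nat_mono)
    \<comment> \<open>\<open>deg\<close> forces k \<ge> 1, so the natural subtraction
      \<open>k - 1\<close> is exact.\<close>
    then have "int (card ?S) \<le> int k - 1 + 2 * int k * int s"
      using deg by (simp add: of_nat_diff algebra_simps)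
    ultimately show ?thesis unfolding m_def by linarith
  qed
  have bound: "l1_norm c \<ge> int T * m - int k * (int T * (int T - 1))" for T
  proof -
    have "int T * m - int k * (int T * (int T - 1)) = (\<Sum>s<T. m - 2 * int k * int s)"
      by (induction T) (simp_all add: algebra_simps)
    also have "\<dots> \<le> (\<Sum>s<T. int (card {i. \<bar>centered_rep (c $ i)\<bar> > int s}))"
      by (rule sum_mono) (rule layer)
    also have "\<dots> \<le> l1_norm c" by (rule l1_norm_layer_cake)
    finally show ?thesis .
  qed
  \<comment> \<open>The layer bounds m - 2ks are nonnegative exactly for s < T, so this T maximizes
    their sum. The overshoot d of 2kT over m satisfies 0 < d \<le> 2k.\<close>
  define T where "T = nat (m div (2 * int k) + 1)"
  define d where "d = 2 * int k * int T - m"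
  have k: "int k > 0" using deg by simp
  have "int T = m div (2 * int k) + 1"
    using m k by (simp add: T_def pos_imp_zdiv_nonneg_iff)
  then have "d = 2 * int k - m mod (2 * int k)"
    unfolding d_def using mult_div_mod_eq[of "2 * int k" m] by (simp only: ring_distribs)
  moreover have "0 \<le> m mod (2 * int k)" "m mod (2 * int k) < 2 * int k"
    using k by simp_all
  \<comment> \<open>This product is exactly the difference of the two sides of the next inequality,
    after substituting 2kT = m + d.\<close>
  ultimately have "0 \<le> d * (2 * int k - d)" by simp
  then have "m * (m + 2 * int k) \<le> 4 * int k * (int T * m - int k * (int T * (int T - 1)))"
    unfolding d_def by (simp add: algebra_simps power2_eq_square)
  also have "\<dots> \<le> 4 * int k * l1_norm c"
    using bound[of T] k by (intro mult_left_mono) auto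
  \<comment> \<open>m (m + 2k) = (n + 1 - k)(n + 1 + k).\<close>
  finally show ?thesis
    unfolding m_def by (simp add: algebra_simps power2_eq_square)
qed

theorem lemma6p4:
  fixes \<alpha> :: "'q::prime_card mod_ring ^ 'n" and n k :: nat and R :: real
  assumes n: "n = CARD('n)"
    and k: "k \<ge> 1"
    and distinct: "\<And>i j. i \<noteq> j \<Longrightarrow> \<alpha> $ i \<noteq> \<alpha> $ j"
    and nonzero: "\<And>i. \<alpha> $ i \<noteq> 0"
    and R: "R = real k / real n"
  shows "(k \<le> n \<longrightarrow> code_rate (GRS k \<alpha> \<alpha>) = R) \<and>
    real_of_int (l1_min_dist (GRS k \<alpha> \<alpha>)) \<ge> ((real n + 1)\<^sup>2 - (real k)\<^sup>2) / (4 * real k) \<and>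
    ((real n + 1)\<^sup>2 - (real k)\<^sup>2) / (4 * real k) > (1 - R\<^sup>2) / (4 * R) * real n"
proof (intro conjI impI)
  have inj: "inj (($) \<alpha>)" using distinct by (meson injI)
  show "code_rate (GRS k \<alpha> \<alpha>) = R" if "k \<le> n"
    using code_rate_GRS[OF inj nonzero] that n R by simp
  \<comment> \<open>The codeword of g = 1 is nonzero, so the minimum is over a nonempty set and is
    attained.\<close>
  have "\<alpha> = (\<chi> i. \<alpha> $ i * poly 1 (\<alpha> $ i))" by (simp add: vec_eq_iff)
  then have "\<alpha> \<in> GRS k \<alpha> \<alpha>"
    using k unfolding GRS_def by (intro CollectI exI[of _ 1]) simp
  moreover have "\<alpha> \<noteq> 0" using nonzero by auto
  ultimately have "l1_min_dist (GRS k \<alpha> \<alpha>) \<in> l1_norm ` (GRS k \<alpha> \<alpha> - {0})"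
    unfolding l1_min_dist_def by (intro Min_in) auto
  then obtain c where c: "c \<in> GRS k \<alpha> \<alpha>" "c \<noteq> 0" "l1_min_dist (GRS k \<alpha> \<alpha>) = l1_norm c"
    by auto
  have "real_of_int ((int n + 1)\<^sup>2 - (int k)\<^sup>2) \<le> real_of_int (4 * int k * l1_norm c)"
    unfolding of_int_le_iff n by (rule l1_norm_GRS_ge[OF inj nonzero c(1,2)])
  then show "real_of_int (l1_min_dist (GRS k \<alpha> \<alpha>)) \<ge> ((real n + 1)\<^sup>2 - (real k)\<^sup>2) / (4 * real k)"
    using k unfolding c(3) by (simp add: divide_le_eq algebra_simps)
  have "n > 0" using n by simp
  then have "(1 - R\<^sup>2) / (4 * R) * real n = ((real n)\<^sup>2 - (real k)\<^sup>2) / (4 * real k)"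
    using k unfolding R by (simp add: field_simps power2_eq_square)
  also have "\<dots> < ((real n + 1)\<^sup>2 - (real k)\<^sup>2) / (4 * real k)"
    using k by (intro divide_strict_right_mono) (simp_all add: power2_eq_square algebra_simps)
  finally show "((real n + 1)\<^sup>2 - (real k)\<^sup>2) / (4 * real k) > (1 - R\<^sup>2) / (4 * R) * real n" .
qed

end
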